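(* Let $\Delta$ be a finite thick spherical building of type $(W,S)$ and let $\theta$ be an automorphism of $\Delta$ with companion automorphism $\sigma$. If $w\in W$ and $s\in S$ with $\ell(sws^{\sigma})=\ell(w)+2$ then $$|\Delta_{ws^{\sigma}}(\theta)|=|\Delta_{sw}(\theta)|\quad\text{and}\quad|\Delta_{sws^{\sigma}}(\theta)|=q_s|\Delta_w(\theta)|+(q_s-1)|\Delta_{sw}(\theta)|.$$
   Context: $\ell$ is the length function of $(W,S)$, $\mathrm{Ch}(\Delta)$ the chamber set and $\delta$ the Weyl distance of $\Delta$. The companion automorphism $\sigma$ of $\theta$ (not necessarily type preserving) is the automorphism of the Coxeter graph with $\delta(C,D)=s\iff\delta(C^\theta,D^\theta)=s^\sigma$. For $s\in S$, $q_s=|\{D\in\mathrm{Ch}(\Delta)\mid\delta(C,D)=s\}|$, which is assumed (as in the paper) to be independent of $C\in\mathrm{Ch}(\Delta)$. For $w\in W$, $\Delta_w(\theta)=\{C\in\mathrm{Ch}(\Delta)\mid\delta(C,C^\theta)=w\}$. *)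

theory Defs
  imports "HOL-Algebra.Algebra"
begin

definition word_prod :: "('w, 'b) monoid_scheme \<Rightarrow> 'w list \<Rightarrow> 'w" where
  "word_prod W ws = foldr (\<otimes>\<^bsub>W\<^esub>) ws \<one>\<^bsub>W\<^esub>"

text \<open>
  One elementary step on words in the alphabet \<open>S\<close>: deletion of a relator \<open>(s t)^m(s,t)\<close>, where
  \<open>m(s,t)\<close> is the order of \<open>s t\<close>. If \<open>s t\<close> has infinite order then \<open>group.ord\<close> yields \<open>0\<close>, the
  relator is the empty word, and no relation is imposed on \<open>s\<close> and \<open>t\<close>.
\<close>

inductive relator_step :: "('w, 'b) monoid_scheme \<Rightarrow> 'w set \<Rightarrow> 'w list \<Rightarrow> 'w list \<Rightarrow> bool"
  for W S where
  "us \<in> lists S \<Longrightarrow> vs \<in> lists S \<Longrightarrow> s \<in> S \<Longrightarrow> t \<in> S \<Longrightarrow>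
    relator_step W S (us @ concat (replicate (group.ord W (s \<otimes>\<^bsub>W\<^esub> t)) [s, t]) @ vs) (us @ vs)"

text \<open>
  The group \<open>W\<close> is presented by \<open>\<langle>S | (s t)^m(s,t) = 1\<rangle>\<close>. Since the relators with \<open>s = t\<close> are the
  words \<open>[s, s]\<close>, each generator is its own inverse modulo the relations, so words in \<open>S\<close> (without
  formal inverses) suffice; two of them agree in the presented group iff they are linked by
  insertions and deletions of relators.
\<close>

locale coxeter_system = group W for W :: "('w, 'b) monoid_scheme" (structure) +
  fixes S :: "'w set"
  assumes S_carrier: "S \<subseteq> carrier W"
    and generator_order: "s \<in> S \<Longrightarrow> ord s = 2"
    and S_generates: "generate W S = carrier W"
    and presentation: "us \<in> lists S \<Longrightarrow> vs \<in> lists S \<Longrightarrow> word_prod W us = word_prod W vs \<Longrightarrow>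
      equivclp (relator_step W S) us vs"
begin

definition len :: "'w \<Rightarrow> nat" where
  "len w = (LEAST n. \<exists>ws \<in> lists S. length ws = n \<and> word_prod W ws = w)"

text \<open>
  Only the action on the generators is recorded. Preserving all the orders \<open>m(s,t)\<close> is the same as
  preserving the edges of the Coxeter graph together with their labels.
\<close>

definition coxeter_graph_automorphism :: "('w \<Rightarrow> 'w) \<Rightarrow> bool" where
  "coxeter_graph_automorphism \<sigma> \<longleftrightarrow>
    bij_betw \<sigma> S S \<and> (\<forall>s \<in> S. \<forall>t \<in> S. ord (\<sigma> s \<otimes> \<sigma> t) = ord (s \<otimes> t))"

end

text \<open>
  Buildings of type \<open>(W,S)\<close> in terms of chambers and Weyl distance: \<open>WD1\<close>--\<open>WD3\<close> are the axioms of
  Abramenko and Brown, \<^emph>\<open>Buildings\<close>, Definition 5.1.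
\<close>

locale building = coxeter_system W S
  for W :: "('w, 'b) monoid_scheme" (structure) and S :: "'w set" +
  fixes Ch :: "'c set" and \<delta> :: "'c \<Rightarrow> 'c \<Rightarrow> 'w"
  assumes Ch_nonempty: "Ch \<noteq> {}"
    and \<delta>_carrier: "C \<in> Ch \<Longrightarrow> D \<in> Ch \<Longrightarrow> \<delta> C D \<in> carrier W"
    and WD1: "C \<in> Ch \<Longrightarrow> D \<in> Ch \<Longrightarrow> \<delta> C D = \<one> \<longleftrightarrow> C = D"
    and WD2: "C \<in> Ch \<Longrightarrow> D \<in> Ch \<Longrightarrow> C' \<in> Ch \<Longrightarrow> s \<in> S \<Longrightarrow> \<delta> C' C = s \<Longrightarrow>
      \<delta> C' D = s \<otimes> \<delta> C D \<or> \<delta> C' D = \<delta> C D"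
    and WD2_longer: "C \<in> Ch \<Longrightarrow> D \<in> Ch \<Longrightarrow> C' \<in> Ch \<Longrightarrow> s \<in> S \<Longrightarrow> \<delta> C' C = s \<Longrightarrow>
      len (s \<otimes> \<delta> C D) = len (\<delta> C D) + 1 \<Longrightarrow> \<delta> C' D = s \<otimes> \<delta> C D"
    and WD3: "C \<in> Ch \<Longrightarrow> D \<in> Ch \<Longrightarrow> s \<in> S \<Longrightarrow>
      \<exists>C' \<in> Ch. \<delta> C' C = s \<and> \<delta> C' D = s \<otimes> \<delta> C D"
begin

text \<open>
  Each panel contains at least three chambers: the \<open>s\<close>-panel of \<open>C\<close> consists of \<open>C\<close> and the chambers
  at Weyl distance \<open>s\<close> from \<open>C\<close>.
\<close>

definition thick :: bool where
  "thick \<longleftrightarrow> (\<forall>C \<in> Ch. \<forall>s \<in> S. \<exists>D \<in> Ch. \<exists>E \<in> Ch. D \<noteq> E \<and> \<delta> C D = s \<and> \<delta> C E = s)"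

definition spherical :: bool where
  "spherical \<longleftrightarrow> finite (carrier W)"

definition companion :: "('c \<Rightarrow> 'c) \<Rightarrow> ('w \<Rightarrow> 'w) \<Rightarrow> bool" where
  "companion \<theta> \<sigma> \<longleftrightarrow> coxeter_graph_automorphism \<sigma> \<and>
    (\<forall>C \<in> Ch. \<forall>D \<in> Ch. \<forall>s \<in> S. \<delta> C D = s \<longleftrightarrow> \<delta> (\<theta> C) (\<theta> D) = \<sigma> s)"

text \<open>
  Automorphisms are given by their action on chambers and need not preserve types.
\<close>

definition automorphism :: "('c \<Rightarrow> 'c) \<Rightarrow> bool" where
  "automorphism \<theta> \<longleftrightarrow> bij_betw \<theta> Ch Ch \<and> (\<exists>\<sigma>. companion \<theta> \<sigma>)"

definition displaced :: "('c \<Rightarrow> 'c) \<Rightarrow> 'w \<Rightarrow> 'c set" where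
  "displaced \<theta> w = {C \<in> Ch. \<delta> C (\<theta> C) = w}"

end

end

theory Submission
  imports Defs
begin

text \<open>
  Put \<open>t = s\<^sup>\<sigma>\<close>. The map \<open>\<theta>\<close> sends each \<open>s\<close>-panel \<open>P\<close> to a \<open>t\<close>-panel. If some chamber of \<open>P\<close> is displaced
  by an element of the double coset \<open>{w, sw, wt, swt}\<close>, then there are \<open>C\<^sub>0 \<in> P\<close> and \<open>B \<in> P\<close> with
  \<open>\<delta>(C\<^sub>0, B\<^sup>\<theta>) = w\<close>, and as lengths add, \<open>\<delta>\<close> on \<open>P \<times> P\<^sup>\<theta>\<close> is determined by this pair. Either \<open>B = C\<^sub>0\<close>, and
  \<open>C\<^sub>0\<close> is displaced by \<open>w\<close> and the other \<open>q\<^sub>s\<close> chambers by \<open>swt\<close>; or \<open>B\<close> is displaced by \<open>sw\<close>, \<open>C\<^sub>0\<close> by \<open>wt\<close>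
  and the other \<open>q\<^sub>s - 1\<close> chambers by \<open>swt\<close>. Both identities therefore hold panel by panel.
\<close>

text \<open>The count on one panel, stripped of geometry. It is meant for \<open>f\<close> sending
  \<open>F\<close> to \<open>\<delta> F (\<theta> F)\<close>, with \<open>w\<close>,
  \<open>x\<close>, \<open>y\<close>, \<open>z\<close> standing for w, sw, wt, swt. If
  \<open>A\<close> and \<open>B\<close> coincide, that point has value \<open>w\<close> and the
  \<open>q\<close> others have value \<open>z\<close>; otherwise each takes one middle value and
  \<open>q - 1\<close> points remain for \<open>z\<close>.\<close>

lemma card_fibres_two_points:
  assumes P: "finite P" "card P = q + 1" and AB: "A \<in> P" "B \<in> P" and dist: "distinct [w, x, y, z]"
    and f: "\<And>F. F \<in> P \<Longrightarrow>
      f F = (if F = A then if F = B then w else y else if F = B then x else z)"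
  shows "card {F \<in> P. f F = y} = card {F \<in> P. f F = x} \<and>
    int (card {F \<in> P. f F = z}) =
      int q * int (card {F \<in> P. f F = w}) + (int q - 1) * int (card {F \<in> P. f F = x})"
proof (cases "A = B")
  case True
  have fibres: "{F \<in> P. f F = w} = {A}" "{F \<in> P. f F = x} = {}"
    "{F \<in> P. f F = y} = {}" "{F \<in> P. f F = z} = P - {A}"
    using dist AB True by (auto simp: f split: if_splits)
  show ?thesis
    unfolding fibres using P AB by simp
next
  case False
  have fibres: "{F \<in> P. f F = w} = {}" "{F \<in> P. f F = x} = {B}"
    "{F \<in> P. f F = y} = {A}" "{F \<in> P. f F = z} = P - {A, B}"
    using dist AB False by (auto simp: f split: if_splits)
  have "card {A, B} \<le> card P"
    using AB P by (intro card_mono) auto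
  then have "int (card (P - {A, B})) = int q - 1"
    using AB P False by (simp add: card_Diff_subset)
  then show ?thesis
    unfolding fibres by simp
qed

section \<open>Words and lengths in a Coxeter system\<close>

context coxeter_system
begin

lemma S_closed [simp]: "s \<in> S \<Longrightarrow> s \<in> carrier W"
  using S_carrier by blast

lemma generator_mult_self [simp]: "s \<in> S \<Longrightarrow> s \<otimes> s = \<one>"
  using generator_order[of s] pow_ord_eq_1[of s] by (simp add: numeral_2_eq_2)

lemma generator_mult_cancel [simp]:
  "s \<in> S \<Longrightarrow> x \<in> carrier W \<Longrightarrow> s \<otimes> (s \<otimes> x) = x"
  by (simp flip: m_assoc)

lemma generator_neq_one: "s \<in> S \<Longrightarrow> s \<noteq> \<one>"
  using generator_order[of s] ord_eq_1[of s] by auto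

lemma word_prod_Nil [simp]: "word_prod W [] = \<one>"
  and word_prod_Cons [simp]: "word_prod W (u # us) = u \<otimes> word_prod W us"
  by (simp_all add: word_prod_def)

lemma word_prod_closed [simp]: "us \<in> lists S \<Longrightarrow> word_prod W us \<in> carrier W"
  by (induction us) auto

lemma word_prod_append:
  "us \<in> lists S \<Longrightarrow> vs \<in> lists S \<Longrightarrow> word_prod W (us @ vs) = word_prod W us \<otimes> word_prod W vs"
  by (induction us) (auto simp: m_assoc)

lemma word_exists:
  assumes "w \<in> carrier W"
  shows "\<exists>us \<in> lists S. word_prod W us = w"
proof -
  have "w \<in> generate W S"
    using assms S_generates by simp
  then show ?thesis
  proof induction
    case one
    show ?case by (rule bexI[of _ "[]"]) auto
  next
    case (incl s)
    then show ?case by (intro bexI[of _ "[s]"]) auto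
  next
    case (inv s)
    \<comment> \<open>Generators are involutions, so words without formal inverses suffice.\<close>
    then have "inv s = s"
      by (intro inv_equality) auto
    then show ?case
      using inv by (intro bexI[of _ "[s]"]) auto
  next
    case (eng x y)
    then obtain us vs where "us \<in> lists S" "word_prod W us = x" "vs \<in> lists S" "word_prod W vs = y"
      by blast
    then show ?case
      by (intro bexI[of _ "us @ vs"]) (auto simp: word_prod_append)
  qed
qed

lemma len_word_prod_le: "us \<in> lists S \<Longrightarrow> len (word_prod W us) \<le> length us"
  unfolding len_def by (rule Least_le) blast

lemma reduced_word_exists:
  assumes "w \<in> carrier W"
  shows "\<exists>us \<in> lists S. length us = len w \<and> word_prod W us = w"
proof -
  have "\<exists>n. \<exists>us \<in> lists S. length us = n \<and> word_prod W us = w"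
    using word_exists[OF assms] by blast
  then show ?thesis
    unfolding len_def by (rule LeastI_ex)
qed

lemma len_mult_le:
  assumes "x \<in> carrier W" "y \<in> carrier W"
  shows "len (x \<otimes> y) \<le> len x + len y"
proof -
  obtain us vs where "us \<in> lists S" "length us = len x" "word_prod W us = x"
    "vs \<in> lists S" "length vs = len y" "word_prod W vs = y"
    using reduced_word_exists assms by meson
  then show ?thesis
    using len_word_prod_le[of "us @ vs"] by (auto simp: word_prod_append)
qed

lemma len_generator_le: "s \<in> S \<Longrightarrow> len s \<le> 1"
  using len_word_prod_le[of "[s]"] by simp

lemma len_generator_mult_le: "s \<in> S \<Longrightarrow> x \<in> carrier W \<Longrightarrow> len (s \<otimes> x) \<le> len x + 1"
  and len_mult_generator_le: "s \<in> S \<Longrightarrow> x \<in> carrier W \<Longrightarrow> len (x \<otimes> s) \<le> len x + 1"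
  using len_mult_le[of s x] len_mult_le[of x s] len_generator_le[of s] by auto

lemma len_eq_0D: "w \<in> carrier W \<Longrightarrow> len w = 0 \<Longrightarrow> w = \<one>"
  using reduced_word_exists[of w] by auto

text \<open>Split off the first letter of a reduced word. The rest cannot be shorter than
  \<open>n\<close>, because one generator raises the length by at most one. This drives the
  inductions on \<open>len w\<close> below.\<close>

lemma len_SucE:
  assumes "w \<in> carrier W" "len w = Suc n"
  obtains u p where "u \<in> S" "p \<in> carrier W" "w = u \<otimes> p" "len p = n"
proof -
  obtain us where us: "us \<in> lists S" "length us = Suc n" "word_prod W us = w"
    using reduced_word_exists assms by metis
  then obtain u vs where vs: "us = u # vs"
    by (cases us) auto
  have *: "u \<in> S" "vs \<in> lists S" "w = u \<otimes> word_prod W vs" "len (word_prod W vs) \<le> n"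
    using us vs len_word_prod_le[of vs] by auto
  moreover have "len (word_prod W vs) = n"
    using * assms len_generator_mult_le[of u "word_prod W vs"] by simp
  ultimately show ?thesis
    using that[of u "word_prod W vs"] by simp
qed

text \<open>Each of the two multiplications adds at most one to the length, so a total gain of two
  forces each to add exactly one, in either order.\<close>

lemma len_double_extension:
  assumes "w \<in> carrier W" "s \<in> S" "t \<in> S" and "len (s \<otimes> w \<otimes> t) = len w + 2"
  shows "len (s \<otimes> w) = len w + 1" "len (w \<otimes> t) = len w + 1"
  using assms len_mult_generator_le[of t "s \<otimes> w"] len_generator_mult_le[of s "w \<otimes> t"]
    len_generator_mult_le[of s w] len_mult_generator_le[of t w]
  by (simp_all add: m_assoc)

text \<open>Lengths separate every pair except \<open>s \<otimes> w\<close> and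
  \<open>w \<otimes> t\<close>; if these were equal, cancelling \<open>t\<close> would give
  \<open>s \<otimes> w \<otimes> t = w\<close>.\<close>

lemma double_coset_distinct:
  assumes w: "w \<in> carrier W" "s \<in> S" "t \<in> S" and len: "len (s \<otimes> w \<otimes> t) = len w + 2"
  shows "distinct [w, s \<otimes> w, w \<otimes> t, s \<otimes> w \<otimes> t]"
proof -
  have "s \<otimes> w \<noteq> w \<otimes> t"
  proof
    assume "s \<otimes> w = w \<otimes> t"
    then have "s \<otimes> w \<otimes> t = w"
      using w by (simp add: m_assoc)
    then show False
      using len by simp
  qed
  moreover have "w \<noteq> s \<otimes> w" "w \<noteq> w \<otimes> t" "w \<noteq> s \<otimes> w \<otimes> t" "s \<otimes> w \<noteq> s \<otimes> w \<otimes> t" "w \<otimes> t \<noteq> s \<otimes> w \<otimes> t"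
    using len len_double_extension[OF assms] by (metis add_cancel_right_right add_left_cancel
        one_eq_numeral_iff semiring_norm(83) zero_neq_one zero_neq_numeral)+
  ultimately show ?thesis by simp
qed

end

section \<open>Weyl distance when the second chamber moves\<close>

context building
begin

lemma \<delta>_self [simp]: "C \<in> Ch \<Longrightarrow> \<delta> C C = \<one>"
  using WD1 by blast

lemma \<delta>_generator_sym:
  assumes "C \<in> Ch" "D \<in> Ch" "s \<in> S" "\<delta> C D = s"
  shows "\<delta> D C = s"
proof -
  have "D \<noteq> C"
    using assms WD1[of C C] generator_neq_one[of s] by blast
  then have "\<delta> D C \<noteq> \<one>"
    using WD1 assms by blast
  \<comment> \<open>\<open>WD2\<close> for the step from \<open>D\<close> to \<open>C\<close>, with
    \<open>C\<close> also as the target.\<close>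
  moreover have "\<one> = s \<otimes> \<delta> D C \<or> \<one> = \<delta> D C"
    using WD2[of D C C s] assms by simp
  ultimately have "s \<otimes> \<one> = s \<otimes> (s \<otimes> \<delta> D C)"
    by auto
  then show ?thesis
    using assms \<delta>_carrier by simp
qed

text \<open>The axioms move only the first chamber; this is the mirror image of
  \<open>WD2_longer\<close>. By induction on \<open>len w\<close>, \<open>C\<close> steps towards
  \<open>D\<close> along the first letter of a reduced word, and \<open>WD2_longer\<close> undoes
  that step once the distance to \<open>E\<close> is known.\<close>

lemma \<delta>_extend_right:
  assumes "w \<in> carrier W" "t \<in> S" "C \<in> Ch" "D \<in> Ch" "E \<in> Ch"
    and "\<delta> C D = w" "\<delta> D E = t" "len (w \<otimes> t) = len w + 1"
  shows "\<delta> C E = w \<otimes> t"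
  using assms
proof (induction "len w" arbitrary: w C)
  case 0
  then have "w = \<one>"
    using len_eq_0D by simp
  with 0 have "C = D"
    using WD1 by blast
  with 0 \<open>w = \<one>\<close> show ?case by simp
next
  case (Suc n)
  then obtain u p where u: "u \<in> S" "p \<in> carrier W" "w = u \<otimes> p" "len p = n"
    using len_SucE by metis
  have len: "len (u \<otimes> (p \<otimes> t)) = n + 2"
    using Suc u by (simp add: m_assoc)
  \<comment> \<open>Removing \<open>u\<close> loses at most one from \<open>n + 2\<close>, and
    appending \<open>t\<close> to \<open>p\<close> gains at most one over \<open>n\<close>.\<close>
  then have len_pt: "len (p \<otimes> t) = n + 1"
    using len_generator_mult_le[of u "p \<otimes> t"] len_mult_generator_le[of t p] u Suc.prems by simp
  obtain C' where C': "C' \<in> Ch" "\<delta> C' C = u" "\<delta> C' D = u \<otimes> w"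
    using WD3[of C D u] u Suc.prems by metis
  then have "\<delta> C' E = p \<otimes> t"
    using Suc.hyps(1)[of p C'] u Suc.prems len_pt by simp
  moreover have "\<delta> C C' = u"
    using \<delta>_generator_sym C' u Suc.prems by blast
  ultimately show ?case
    using WD2_longer[of C' E C u] len len_pt u C' Suc.prems by (simp add: m_assoc)
qed

text \<open>The mirror image of \<open>WD3\<close> for a descending step, by the same induction:
  \<open>E\<close> is the last chamber before \<open>D\<close> on a minimal gallery whose type ends
  in \<open>t\<close>.\<close>

lemma \<delta>_shorten_right:
  assumes "w \<in> carrier W" "t \<in> S" "C \<in> Ch" "D \<in> Ch"
    and "\<delta> C D = w \<otimes> t" "len (w \<otimes> t) = len w + 1"
  shows "\<exists>E \<in> Ch. \<delta> E D = t \<and> \<delta> C E = w"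
  using assms
proof (induction "len w" arbitrary: w C)
  case 0
  then have "w = \<one>"
    using len_eq_0D by simp
  with 0 show ?case
    by (intro bexI[of _ C]) auto
next
  case (Suc n)
  then obtain u p where u: "u \<in> S" "p \<in> carrier W" "w = u \<otimes> p" "len p = n"
    using len_SucE by metis
  have len: "len (u \<otimes> (p \<otimes> t)) = n + 2"
    using Suc u by (simp add: m_assoc)
  then have len_pt: "len (p \<otimes> t) = n + 1"
    using len_generator_mult_le[of u "p \<otimes> t"] len_mult_generator_le[of t p] u Suc.prems by simp
  obtain C' where C': "C' \<in> Ch" "\<delta> C' C = u" "\<delta> C' D = u \<otimes> (w \<otimes> t)"
    using WD3[of C D u] u Suc.prems by metis
  then obtain E where E: "E \<in> Ch" "\<delta> E D = t" "\<delta> C' E = p"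
    using Suc.hyps(1)[of p C'] u Suc.prems len_pt by (auto simp: m_assoc)
  moreover have "\<delta> C C' = u"
    using \<delta>_generator_sym C' u Suc.prems by blast
  ultimately have "\<delta> C E = w"
    using WD2_longer[of C' E C u] u C' Suc.hyps(2) Suc.prems by simp
  with E show ?case by blast
qed

section \<open>Panels and distances between two panels\<close>

definition panel :: "'w \<Rightarrow> 'c \<Rightarrow> 'c set" where
  "panel s C = insert C {D \<in> Ch. \<delta> C D = s}"

lemma self_in_panel [simp]: "C \<in> panel s C"
  by (simp add: panel_def)

lemma panel_subset: "C \<in> Ch \<Longrightarrow> panel s C \<subseteq> Ch"
  by (auto simp: panel_def)

lemma panel_mono:
  assumes "C \<in> Ch" "s \<in> S" "D \<in> panel s C"
  shows "panel s D \<subseteq> panel s C"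
proof
  fix E assume E: "E \<in> panel s D"
  have "E \<in> Ch" "D \<in> Ch"
    using assms E panel_subset by blast+
  show "E \<in> panel s C"
  proof (cases "D = C \<or> E = D")
    case True
    then show ?thesis using E assms by auto
  next
    case False
    \<comment> \<open>Transitivity of adjacency: the first alternative is distance
      \<open>\<one>\<close>, that is, \<open>E = C\<close>.\<close>
    then have "\<delta> C E = s \<otimes> s \<or> \<delta> C E = s"
      using WD2[of D E C s] E assms \<open>D \<in> Ch\<close> by (auto simp: panel_def)
    then show ?thesis
      using WD1[of C E] \<open>E \<in> Ch\<close> assms by (auto simp: panel_def)
  qed
qed

lemma panel_sym: "C \<in> Ch \<Longrightarrow> s \<in> S \<Longrightarrow> D \<in> panel s C \<Longrightarrow> C \<in> panel s D"
  using \<delta>_generator_sym by (auto simp: panel_def)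

lemma panel_eq: "C \<in> Ch \<Longrightarrow> s \<in> S \<Longrightarrow> D \<in> panel s C \<Longrightarrow> panel s D = panel s C"
  using panel_mono panel_sym panel_subset by (metis subset_antisym subsetD)

lemma \<delta>_between_panels:
  assumes w: "w \<in> carrier W" "s \<in> S" "t \<in> S" and len: "len (s \<otimes> w \<otimes> t) = len w + 2"
    and Ch: "C \<in> Ch" "D \<in> Ch" "\<delta> C D = w"
    and mem: "C' \<in> panel s C" "D' \<in> panel t D"
  shows "\<delta> C' D' = (if C' = C then if D' = D then w else w \<otimes> t
                    else if D' = D then s \<otimes> w else s \<otimes> w \<otimes> t)"
proof -
  note lens = len_double_extension[OF w len]
  have C': "C' \<in> Ch" "C' = C \<or> \<delta> C' C = s"
    using mem Ch w panel_sym[of C s C'] panel_subset[of C s] by (auto simp: panel_def)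
  have D': "D' \<in> Ch" "D' = D \<or> \<delta> D D' = t"
    using mem Ch by (auto simp: panel_def)
  have CD': "\<delta> C D' = (if D' = D then w else w \<otimes> t)"
    using \<delta>_extend_right[of w t C D D'] w Ch D' lens by auto
  show ?thesis
  proof (cases "C' = C")
    case True
    then show ?thesis using CD' by simp
  next
    case False
    \<comment> \<open>Left multiplication by \<open>s\<close> lengthens both possible values of
      \<open>\<delta> C D'\<close>, namely \<open>w\<close> and
      \<open>w \<otimes> t\<close>.\<close>
    then have "\<delta> C' D' = s \<otimes> \<delta> C D'"
      using WD2_longer[of C D' C' s] C' D' CD' Ch w len lens by (auto simp: m_assoc)
    then show ?thesis
      using CD' False w by (simp add: m_assoc)
  qed
qed

text \<open>First \<open>C\<close> moves in its \<open>s\<close>-panel to strip a leading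
  \<open>s\<close> from the distance, then \<open>D\<close> moves in its \<open>t\<close>-panel to
  strip a trailing \<open>t\<close>.\<close>

lemma closest_pair_exists:
  assumes w: "w \<in> carrier W" "s \<in> S" "t \<in> S" and len: "len (s \<otimes> w \<otimes> t) = len w + 2"
    and Ch: "C \<in> Ch" "D \<in> Ch"
    and mem: "\<delta> C D \<in> {w, s \<otimes> w, w \<otimes> t, s \<otimes> w \<otimes> t}"
  shows "\<exists>C' \<in> panel s C. \<exists>D' \<in> panel t D. \<delta> C' D' = w"
proof -
  obtain C' where C': "C' \<in> panel s C" "\<delta> C' D \<in> {w, w \<otimes> t}"
  proof (cases "\<delta> C D \<in> {w, w \<otimes> t}")
    case True
    then show ?thesis using that[of C] by simp
  next
    case False
    obtain E where "E \<in> Ch" "\<delta> E C = s" "\<delta> E D = s \<otimes> \<delta> C D"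
      using WD3[OF Ch \<open>s \<in> S\<close>] by blast
    then show ?thesis
      using that[of E] False mem w \<delta>_generator_sym[of E C s] Ch by (auto simp: panel_def m_assoc)
  qed
  have "C' \<in> Ch"
    using C' Ch panel_subset by blast
  obtain D' where "D' \<in> panel t D" "\<delta> C' D' = w"
  proof (cases "\<delta> C' D = w")
    case True
    then show ?thesis using that[of D] by simp
  next
    case False
    then obtain E where "E \<in> Ch" "\<delta> E D = t" "\<delta> C' E = w"
      using \<delta>_shorten_right[of w t C' D] C' \<open>C' \<in> Ch\<close> w Ch len_double_extension[OF w len] by auto
    then show ?thesis
      using that[of E] \<delta>_generator_sym[of E D t] Ch w by (auto simp: panel_def)
  qed
  with C' show ?thesis by blast
qed

section \<open>The action of the automorphism on panels, and the count\<close>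

lemma companion_panel:
  assumes "companion \<theta> \<sigma>" "bij_betw \<theta> Ch Ch" "s \<in> S" "C \<in> Ch"
  shows "panel (\<sigma> s) (\<theta> C) = \<theta> ` panel s C"
proof -
  have "D \<in> \<theta> ` panel s C" if "D \<in> panel (\<sigma> s) (\<theta> C)" for D
  proof (cases "D = \<theta> C")
    case False
    with that have "D \<in> \<theta> ` Ch"
      using assms(2) by (auto simp: panel_def bij_betw_def)
    then obtain B where "B \<in> Ch" "D = \<theta> B"
      by blast
    with False that assms show ?thesis
      by (auto simp: panel_def companion_def)
  qed simp
  moreover have "\<theta> B \<in> panel (\<sigma> s) (\<theta> C)" if "B \<in> panel s C" for B
    using that assms bij_betwE[OF assms(2)] by (auto simp: panel_def companion_def)
  ultimately show ?thesis by blast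
qed

lemma card_displaced_panel:
  assumes fin: "finite Ch"
    and comp: "companion \<theta> \<sigma>" and bij: "bij_betw \<theta> Ch Ch"
    and w: "w \<in> carrier W" "s \<in> S" and len: "len (s \<otimes> w \<otimes> \<sigma> s) = len w + 2"
    and C: "C \<in> Ch" and q: "card {D \<in> Ch. \<delta> C D = s} = q"
  defines "n v \<equiv> card (displaced \<theta> v \<inter> panel s C)"
  shows "n (w \<otimes> \<sigma> s) = n (s \<otimes> w)"
    and "int (n (s \<otimes> w \<otimes> \<sigma> s)) = int q * int (n w) + (int q - 1) * int (n (s \<otimes> w))"
proof -
  define t where "t = \<sigma> s"
  define P where "P = panel s C"
  have t: "t \<in> S"
    using comp w bij_betwE by (fastforce simp: companion_def coxeter_graph_automorphism_def t_def)
  note len = len[folded t_def]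
  \<comment> \<open>The extra one is \<open>C\<close> itself, which is not at distance
    \<open>s\<close> from itself because \<open>s \<noteq> \<one>\<close>.\<close>
  have P: "finite P" "card P = q + 1" "P \<subseteq> Ch"
    using C fin q generator_neq_one[OF \<open>s \<in> S\<close>] panel_subset[of C s]
    by (auto simp: P_def panel_def)
  have theta: "\<theta> E \<in> Ch" if "E \<in> Ch" for E
    using bij that bij_betwE by blast
  have inj: "\<theta> E = \<theta> F \<longleftrightarrow> E = F" if "E \<in> P" "F \<in> P" for E F
    using bij that P(3) by (auto simp: bij_betw_def inj_on_def)
  have P_eq: "panel s E = P" if "E \<in> P" for E
    using that C w panel_eq unfolding P_def by blast
  have n: "n v = card {E \<in> P. \<delta> E (\<theta> E) = v}" for v
    unfolding n_def displaced_def P_def[symmetric] using P(3) by (intro arg_cong[where f = card]) auto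
  have "n (w \<otimes> t) = n (s \<otimes> w) \<and>
    int (n (s \<otimes> w \<otimes> t)) = int q * int (n w) + (int q - 1) * int (n (s \<otimes> w))"
  proof (cases "\<exists>E \<in> P. \<delta> E (\<theta> E) \<in> {w, s \<otimes> w, w \<otimes> t, s \<otimes> w \<otimes> t}")
    case False
    then have "n v = 0" if "v \<in> {w, s \<otimes> w, w \<otimes> t, s \<otimes> w \<otimes> t}" for v
      using that unfolding n by (auto simp: card_eq_0_iff)
    then show ?thesis by simp
  next
    case True
    then obtain E where E: "E \<in> P" "\<delta> E (\<theta> E) \<in> {w, s \<otimes> w, w \<otimes> t, s \<otimes> w \<otimes> t}"
      by blast
    then have "E \<in> Ch" using P by blast
    obtain A D where "A \<in> panel s E" "D \<in> panel t (\<theta> E)" "\<delta> A D = w"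
      using closest_pair_exists[OF w t len \<open>E \<in> Ch\<close> theta[OF \<open>E \<in> Ch\<close>]] E by blast
    \<comment> \<open>The \<open>t\<close>-panel of \<open>\<theta> E\<close> is the image of
      \<open>P\<close>, so \<open>D\<close> is pulled back to some \<open>B\<close> in
      \<open>P\<close>, possibly different from \<open>A\<close>.\<close>
    then obtain B where AB: "A \<in> P" "B \<in> P" "\<delta> A (\<theta> B) = w"
      using companion_panel[OF comp bij \<open>s \<in> S\<close> \<open>E \<in> Ch\<close>] P_eq E by (auto simp: t_def)
    have AB_Ch: "A \<in> Ch" "B \<in> Ch"
      using AB P by auto
    \<comment> \<open>The formula for pairs of panels is read along the graph of
      \<open>\<theta>\<close>; by injectivity, \<open>\<theta> F\<close> meets the base chamber
      \<open>\<theta> B\<close> exactly when \<open>F = B\<close>.\<close>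
    have \<delta>: "\<delta> F (\<theta> F) = (if F = A then if F = B then w else w \<otimes> t
        else if F = B then s \<otimes> w else s \<otimes> w \<otimes> t)" if "F \<in> P" for F
      using \<delta>_between_panels[OF w t len AB_Ch(1) theta[OF AB_Ch(2)] AB(3), of F "\<theta> F"]
        that AB P_eq companion_panel[OF comp bij \<open>s \<in> S\<close> AB_Ch(2)] inj by (simp add: t_def)
    show ?thesis
      unfolding n using card_fibres_two_points[OF P(1,2) AB(1,2) double_coset_distinct[OF w t len] \<delta>] .
  qed
  then show "n (w \<otimes> \<sigma> s) = n (s \<otimes> w)"
    and "int (n (s \<otimes> w \<otimes> \<sigma> s)) = int q * int (n w) + (int q - 1) * int (n (s \<otimes> w))"
    by (simp_all add: t_def)
qed

text \<open>The \<open>s\<close>-panels partition \<open>Ch\<close>: they are the fibres of the map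
  \<open>panel s\<close>.\<close>

lemma card_eq_sum_panels:
  assumes "finite Ch" "s \<in> S" "A \<subseteq> Ch"
  shows "card A = (\<Sum>P \<in> panel s ` Ch. card (A \<inter> P))"
proof -
  have "card A = (\<Sum>P \<in> panel s ` Ch. card {C \<in> A. panel s C = P})"
    using sum.group[of A "panel s ` Ch" "panel s" "\<lambda>_. 1 :: nat"] assms
    by (simp add: finite_subset image_mono)
  also have "\<dots> = (\<Sum>P \<in> panel s ` Ch. card (A \<inter> P))"
  proof (rule sum.cong[OF refl])
    fix P assume "P \<in> panel s ` Ch"
    then obtain D where "D \<in> Ch" "P = panel s D" by blast
    then have "{C \<in> A. panel s C = P} = A \<inter> P"
      using assms panel_eq[of D s] self_in_panel by blast
    then show "card {C \<in> A. panel s C = P} = card (A \<inter> P)" by simp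
  qed
  finally show ?thesis .
qed

end

theorem theorem2p15:
  fixes W :: "('w, 'b) monoid_scheme" (structure)
    and S :: "'w set"
    and Ch :: "'c set"
    and \<delta> :: "'c \<Rightarrow> 'c \<Rightarrow> 'w"
    and \<theta> :: "'c \<Rightarrow> 'c"
    and \<sigma> :: "'w \<Rightarrow> 'w"
    and q :: "'w \<Rightarrow> nat"
    and w s :: 'w
  assumes "building W S Ch \<delta>"
    and "finite Ch"
    and "building.thick S Ch \<delta>"
    and "building.spherical W"
    and "building.automorphism W S Ch \<delta> \<theta>"
    and "building.companion W S Ch \<delta> \<theta> \<sigma>"
    and "\<forall>t \<in> S. \<forall>C \<in> Ch. card {D \<in> Ch. \<delta> C D = t} = q t"
    and "w \<in> carrier W"
    and "s \<in> S"
    and "coxeter_system.len W S (s \<otimes> w \<otimes> \<sigma> s) = coxeter_system.len W S w + 2"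
  shows "card (building.displaced Ch \<delta> \<theta> (w \<otimes> \<sigma> s)) = card (building.displaced Ch \<delta> \<theta> (s \<otimes> w)) \<and>
    int (card (building.displaced Ch \<delta> \<theta> (s \<otimes> w \<otimes> \<sigma> s))) =
      int (q s) * int (card (building.displaced Ch \<delta> \<theta> w))
      + (int (q s) - 1) * int (card (building.displaced Ch \<delta> \<theta> (s \<otimes> w)))"
proof -
  interpret building W S Ch \<delta> by fact
  have bij: "bij_betw \<theta> Ch Ch"
    using assms(5) by (simp add: automorphism_def)
  have sum: "card (displaced \<theta> v) = (\<Sum>P \<in> panel s ` Ch. card (displaced \<theta> v \<inter> P))" for v
    using card_eq_sum_panels[OF \<open>finite Ch\<close> \<open>s \<in> S\<close>] by (simp add: displaced_def)
  have panel: "card (displaced \<theta> (w \<otimes> \<sigma> s) \<inter> P) = card (displaced \<theta> (s \<otimes> w) \<inter> P)"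
    "int (card (displaced \<theta> (s \<otimes> w \<otimes> \<sigma> s) \<inter> P)) =
      int (q s) * int (card (displaced \<theta> w \<inter> P)) + (int (q s) - 1) * int (card (displaced \<theta> (s \<otimes> w) \<inter> P))"
    if "P \<in> panel s ` Ch" for P
    using that assms(7,9)
      card_displaced_panel[OF \<open>finite Ch\<close> \<open>companion \<theta> \<sigma>\<close> bij \<open>w \<in> carrier W\<close> \<open>s \<in> S\<close> assms(10)]
    by blast+
  show ?thesis
    \<comment> \<open>Both identities are linear in the cardinalities, and \<open>q s\<close> is the
      same for every panel, so the local identities add up.\<close>
    unfolding sum by (simp add: panel sum_distrib_left sum.distrib)
qed

end
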